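(* Consider the system $x_{k+1}=Ax_k+Bu_k+w_k$ with arbitrary disturbances $w_k\in\mathcal W$, let $N_0\ge 1$ be an initial horizon length, and let $M_0\in\mathbb R^{N_0\times\bar N}$ be a blocking matrix with $\bar N\le\bar N_{\max}$. Define the matrices $M_k=\Gamma(M_{k-1})$ for $k=1,\dots,N_0-1$, where every split performed by $\Gamma$ uses an arbitrary admissible pair $(j,i)$. Suppose that $\mathbb P(x_0,M_0)$ has a solution (is feasible), and that the system is controlled at each time $k=0,\dots,N_0-1$ by $$u_k=v_0^*(k)-K\bigl(x_k-z_0^*(k)\bigr),$$ where $v_0^*(k)$ and $z_0^*(k)$ are part of an optimal solution of $\mathbb P(x_k,M_k)$ (that is, of $\mathbb P(x_0,M_0)$ for $k=0$ and of $\mathbb P(x_k,\Gamma(M_{k-1}))$ for $k\ge1$). Then, for all disturbance realizations $w_k\in\mathcal W$: 1) $\mathbb P(x_k,\Gamma(M_{k-1}))$ is feasible for all $k\in\{1,\dots,N_0-1\}$; 2) $x_{N_0}\in\mathcal X_T$.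
   Context: **System and sets.** $A\in\mathbb R^{n\times n}$, $B\in\mathbb R^{n\times m}$ with $(A,B)$ stabilizable. $\mathcal F\subseteq\mathbb R^{n+m}$ (state-input constraints, ordered as (state, input)), $\mathcal X_T\subseteq\mathbb R^n$ (terminal set) and $\mathcal W\subseteq\mathbb R^n$ (disturbance set) are polytopes containing the origin. For sets, $\mathcal S_1\oplus\mathcal S_2=\{a+b: a\in\mathcal S_1,b\in\mathcal S_2\}$ and $\mathcal S_1\ominus\mathcal S_2=\{a:\{a\}\oplus\mathcal S_2\subseteq\mathcal S_1\}$. For vectors, $(a_1,\dots,a_r)$ denotes vertical concatenation. $K\in\mathbb R^{m\times n}$ is such that $x_{k+1}=A_Kx_k$ with $A_K=A-BK$ is stable. $\mathcal Z\subseteq\mathbb R^n$ is a robust positively invariant (RPI) set, i.e. $A_K\mathcal Z\oplus\mathcal W\subseteq\mathcal Z$. The tightened sets are $\bar{\mathcal F}=\mathcal F\ominus(\mathcal Z\times K\mathcal Z)$ and $\bar{\mathcal X}_T=\mathcal X_T\ominus\mathcal Z$. **Blocking matrices.** For $s=(s_1,\dots,s_{\bar N})$ with $s_i\in\mathbb N^+$ and $\sum_i s_i=N$, the blocking matrix is $\mathbf M(s)=\mathrm{diag}(\mathbf 1_{s_1\times1},\dots,\mathbf 1_{s_{\bar N}\times1})\in\mathbb R^{N\times\bar N}$ (block diagonal, $\mathbf 1_{s\times 1}$ the all-ones column); $s$ is its blocking vector. The same terminology is used for matrices obtained from these by deleting leading rows, which may have zero columns (corresponding to blocking lengths $s_i=0$).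 $\bar N_{\max}\ge1$ is a given integer. **Optimization problem.** Let $N_k=N_0-k$. For a matrix $M\in\mathbb R^{N_k\times\bar N}$ and $x_k\in\mathbb R^n$, $\mathbb P(x_k,M)$ is: minimize over $z_0\in\mathbb R^n$ and $\bar V=(\bar v_0,\dots,\bar v_{\bar N-1})\in\mathbb R^{\bar Nm}$ the cost $\sum_{i=0}^{N_k-1}(z_i,v_i)^TH(z_i,v_i)+z_{N_k}^TPz_{N_k}$ subject to $x_k\in z_0\oplus\mathcal Z$, $z_{N_k}\in\bar{\mathcal X}_T$, $V=(v_0,\dots,v_{N_k-1})=(M\otimes I_m)\bar V$, and, for $i=0,\dots,N_k-1$, $z_{i+1}=Az_i+Bv_i$ and $(z_i,v_i)\in\bar{\mathcal F}$. Here $H,P$ are positive definite and $\otimes$ is the Kronecker product. Feasible means that some $(\bar V,z_0)$ satisfies the constraints. It is understood that the minimum is attained whenever the problem is feasible. An optimal solution for $M=M_k$ is denoted $\bar V^*(k),z_0^*(k)$, and $v_0^*(k)$ is the first block of $V^*(k)=(M_k\otimes I_m)\bar V^*(k)$. **Splitting.** For a blocking matrix $M=\mathbf M(s)$ with $s=(s_1,\dots,s_q)$, $s_i\in\mathbb N^+$, an admissible pair is $(j,i)$ with $j\in\{1,\dots,q\}$, $s_j>1$, $i\in\{1,\dots,s_j-1\}$. For such a pair, $\mathrm{split}(M)=\mathbf M(s_1,\dots,s_{j-1},\,s_j-i,\,i,\,s_{j+1},\dots,s_q)$. **The map $\Gamma$.** For $M_k\in\mathbb R^{N_k\times\bar N}$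 let $R=[\mathbf 0_{(N_k-1)\times1},I_{N_k-1}]$ and $G=[\mathbf 0_{(\bar N-1)\times1},I_{\bar N-1}]^T\in\mathbb R^{\bar N\times(\bar N-1)}$. Then $$\Gamma(M_k)=\begin{cases}\mathrm{split}(RM_kG)&\text{if }s_{1,k}=1\text{ and }N_k>\bar N_{\max},\\ RM_k&\text{otherwise,}\end{cases}$$ where $s_{1,k}$ is the first entry of the blocking vector of $M_k$. *)

theory Defs
  imports "HOL-Analysis.Analysis" "Jordan_Normal_Form.Matrix"
begin

(* The state space R^n and the input space R^m are the types real^'n and real^'m.  Blocking
   matrices, whose dimensions change from one time step to the next, are matrices with explicit
   dimensions (type real mat); a vector in R^(q m) made of q blocks of length m has type
   (real^'m) Matrix.vec, with dimension q. *)

no_notation vec_index (infixl \<open>$\<close> 100)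
no_notation scalar_prod (infix \<open>\<bullet>\<close> 70)


definition asymptotically_stable :: "real^'n^'n \<Rightarrow> bool" where
  "asymptotically_stable A \<longleftrightarrow>
     (\<forall>\<epsilon>>0. \<exists>\<delta>>0. \<forall>x. norm x < \<delta> \<longrightarrow> (\<forall>k. norm (((*v) A ^^ k) x) < \<epsilon>)) \<and>
     (\<forall>x. (\<lambda>k. ((*v) A ^^ k) x) \<longlonglongrightarrow> 0)"

definition stabilizable :: "real^'n^'n \<Rightarrow> real^'m^'n \<Rightarrow> bool" where
  "stabilizable A B \<longleftrightarrow> (\<exists>L :: real^'n^'m. asymptotically_stable (A - B ** L))"

definition positive_definite :: "real^'i^'i \<Rightarrow> bool" where
  "positive_definite Q \<longleftrightarrow>
     Finite_Cartesian_Product.transpose Q = Q \<and> (\<forall>y. y \<noteq> 0 \<longrightarrow> y \<bullet> (Q *v y) > 0)"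

definition vcat :: "real^'n \<Rightarrow> real^'m \<Rightarrow> real^('n + 'm)" where
  "vcat a b = (\<chi> i. case i of Inl p \<Rightarrow> a $ p | Inr q \<Rightarrow> b $ q)"

definition set_vcat :: "(real^'n) set \<Rightarrow> (real^'m) set \<Rightarrow> (real^('n + 'm)) set" where
  "set_vcat S T = {vcat a b | a b. a \<in> S \<and> b \<in> T}"

definition pontryagin_diff :: "'a::plus set \<Rightarrow> 'a set \<Rightarrow> 'a set" where
  "pontryagin_diff S T = {a. {a} + T \<subseteq> S}"

definition robust_positively_invariant ::
    "real^'n^'n \<Rightarrow> (real^'n) set \<Rightarrow> (real^'n) set \<Rightarrow> bool" where
  "robust_positively_invariant AK W Z \<longleftrightarrow> (*v) AK ` Z + W \<subseteq> Z"


definition blocking_matrix :: "nat list \<Rightarrow> real mat" where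
  "blocking_matrix s = diag_block_mat (map (\<lambda>l. mat l 1 (\<lambda>_. 1)) s)"

definition is_blocking_matrix :: "real mat \<Rightarrow> bool" where
  "is_blocking_matrix M \<longleftrightarrow> (\<exists>s. (\<forall>l\<in>set s. l > 0) \<and> M = blocking_matrix s)"

(* The results of splitting M at all admissible pairs; positions j are counted from 0. *)
definition splits :: "real mat \<Rightarrow> real mat set" where
  "splits M = {blocking_matrix (take j s @ [s ! j - i, i] @ drop (Suc j) s) | s j i.
     (\<forall>l\<in>set s. l > 0) \<and> M = blocking_matrix s \<and>
     j < length s \<and> s ! j > 1 \<and> 1 \<le> i \<and> i \<le> s ! j - 1}"

(* The r x (r+1) matrix [0, I]. *)
definition zero_id :: "nat \<Rightarrow> real mat" where
  "zero_id r = four_block_mat (0\<^sub>m r 1) (1\<^sub>m r) (0\<^sub>m 0 1) (0\<^sub>m 0 r)"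

(* The set of all values that Gamma may take at M, over all admissible pairs.  The blocking
   vector s may contain zeros here; it is determined by M, its entries being the column sums. *)
definition Gamma_values :: "nat \<Rightarrow> real mat \<Rightarrow> real mat set" where
  "Gamma_values Nmax M = {M'. \<exists>s. s \<noteq> [] \<and> M = blocking_matrix s \<and>
     (let R = zero_id (dim_row M - 1); G = transpose_mat (zero_id (dim_col M - 1)) in
      if hd s = 1 \<and> dim_row M > Nmax then M' \<in> splits (R * M * G) else M' = R * M)}"


(* The Kronecker product of M and C, as the block matrix with blocks M_ij C. *)
definition kronecker :: "real mat \<Rightarrow> real^'b^'a \<Rightarrow> (real^'b^'a) mat" where
  "kronecker M C = map_mat (\<lambda>c. c *\<^sub>R C) M"

definition block_mult_vec :: "(real^'b^'a) mat \<Rightarrow> (real^'b) Matrix.vec \<Rightarrow> (real^'a) Matrix.vec"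
  where "block_mult_vec T V =
    Matrix.vec (dim_row T) (\<lambda>i. \<Sum>j<dim_col T. T $$ (i, j) *v vec_index V j)"

definition blocked_inputs :: "real mat \<Rightarrow> (real^'m) Matrix.vec \<Rightarrow> (real^'m) Matrix.vec" where
  "blocked_inputs M Vbar =
     block_mult_vec (kronecker M (Finite_Cartesian_Product.mat 1 :: real^'m^'m)) Vbar"

primrec nominal_state ::
    "real^'n^'n \<Rightarrow> real^'m^'n \<Rightarrow> real^'n \<Rightarrow> (real^'m) Matrix.vec \<Rightarrow> nat \<Rightarrow> real^'n" where
  "nominal_state A B z0 V 0 = z0"
| "nominal_state A B z0 V (Suc i) = A *v nominal_state A B z0 V i + B *v vec_index V i"

(* (z0, Vbar) satisfies the constraints of the problem P(x, M); the horizon is dim_row M. *)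
definition mpc_constraints ::
    "real^'n^'n \<Rightarrow> real^'m^'n \<Rightarrow> real^'n^'m \<Rightarrow> (real^('n + 'm)) set \<Rightarrow> (real^'n) set \<Rightarrow> (real^'n) set
      \<Rightarrow> real^'n \<Rightarrow> real mat \<Rightarrow> real^'n \<Rightarrow> (real^'m) Matrix.vec \<Rightarrow> bool" where
  "mpc_constraints A B K F XT Z x M z0 Vbar \<longleftrightarrow>
     Vbar \<in> carrier_vec (dim_col M) \<and>
     (let V = blocked_inputs M Vbar; z = nominal_state A B z0 V in
        x \<in> {z0} + Z \<and>
        z (dim_row M) \<in> pontryagin_diff XT Z \<and>
        (\<forall>i<dim_row M.
           vcat (z i) (vec_index V i) \<in> pontryagin_diff F (set_vcat Z ((*v) K ` Z))))"

definition mpc_cost ::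
    "real^'n^'n \<Rightarrow> real^'m^'n \<Rightarrow> real^('n + 'm)^('n + 'm) \<Rightarrow> real^'n^'n
      \<Rightarrow> real mat \<Rightarrow> real^'n \<Rightarrow> (real^'m) Matrix.vec \<Rightarrow> real" where
  "mpc_cost A B H P M z0 Vbar =
     (let V = blocked_inputs M Vbar; z = nominal_state A B z0 V in
        (\<Sum>i<dim_row M. vcat (z i) (vec_index V i) \<bullet> (H *v vcat (z i) (vec_index V i)))
        + z (dim_row M) \<bullet> (P *v z (dim_row M)))"

definition mpc_feasible ::
    "real^'n^'n \<Rightarrow> real^'m^'n \<Rightarrow> real^'n^'m \<Rightarrow> (real^('n + 'm)) set \<Rightarrow> (real^'n) set \<Rightarrow> (real^'n) set
      \<Rightarrow> real^'n \<Rightarrow> real mat \<Rightarrow> bool" where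
  "mpc_feasible A B K F XT Z x M \<longleftrightarrow> (\<exists>z0 Vbar. mpc_constraints A B K F XT Z x M z0 Vbar)"

definition mpc_optimal ::
    "real^'n^'n \<Rightarrow> real^'m^'n \<Rightarrow> real^'n^'m \<Rightarrow> (real^('n + 'm)) set \<Rightarrow> (real^'n) set \<Rightarrow> (real^'n) set
      \<Rightarrow> real^('n + 'm)^('n + 'm) \<Rightarrow> real^'n^'n
      \<Rightarrow> real^'n \<Rightarrow> real mat \<Rightarrow> real^'n \<Rightarrow> (real^'m) Matrix.vec \<Rightarrow> bool" where
  "mpc_optimal A B K F XT Z H P x M z0 Vbar \<longleftrightarrow>
     mpc_constraints A B K F XT Z x M z0 Vbar \<and>
     (\<forall>z0' Vbar'. mpc_constraints A B K F XT Z x M z0' Vbar'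
        \<longrightarrow> mpc_cost A B H P M z0 Vbar \<le> mpc_cost A B H P M z0' Vbar')"

end

theory Submission
  imports Defs
begin

(* Shifting an optimal solution by one step, (z_{i+1}, v_{i+1}), satisfies the constraints of the
   next problem: the tube absorbs w_k because Z is robustly invariant, and Gamma only loses
   degrees of freedom that the shifted input sequence does not use.  Deleting the leading row
   keeps Vbar; deleting a used-up block drops its first entry; a split duplicates the entry of
   the split block. *)

section \<open>Deleting the first row and column of a blocking matrix\<close>

lemma zero_id_dim [simp]: "dim_row (zero_id r) = r" "dim_col (zero_id r) = Suc r"
  by (simp_all add: zero_id_def)

lemma zero_id_index:
  assumes "i < r" "j < Suc r"
  shows "zero_id r $$ (i, j) = (if j = Suc i then 1 else 0)"
  using assms by (auto simp: zero_id_def)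

lemma zero_id_mult_index:
  assumes "dim_row M = Suc r" "i < r" "j < dim_col M"
  shows "(zero_id r * M) $$ (i, j) = M $$ (Suc i, j)"
proof -
  have "(zero_id r * M) $$ (i, j) = (\<Sum>l<Suc r. zero_id r $$ (i, l) * M $$ (l, j))"
    using assms by (simp add: times_mat_def scalar_prod_def atLeast0LessThan del: sum.lessThan_Suc)
  also have "\<dots> = (\<Sum>l<Suc r. if l = Suc i then M $$ (l, j) else 0)"
    using assms by (intro sum.cong) (auto simp: zero_id_index)
  also have "\<dots> = M $$ (Suc i, j)"
    using assms by (simp add: sum.delta del: sum.lessThan_Suc)
  finally show ?thesis .
qed

lemma mult_transpose_zero_id_index:
  assumes "dim_col M = Suc r" "i < dim_row M" "j < r"
  shows "(M * transpose_mat (zero_id r)) $$ (i, j) = M $$ (i, Suc j)"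
proof -
  have "(M * transpose_mat (zero_id r)) $$ (i, j) = (\<Sum>l<Suc r. M $$ (i, l) * zero_id r $$ (j, l))"
    using assms by (simp add: times_mat_def scalar_prod_def atLeast0LessThan del: sum.lessThan_Suc)
  also have "\<dots> = (\<Sum>l<Suc r. if l = Suc j then M $$ (i, l) else 0)"
    using assms by (intro sum.cong) (auto simp: zero_id_index)
  also have "\<dots> = M $$ (i, Suc j)"
    using assms by (simp add: sum.delta del: sum.lessThan_Suc)
  finally show ?thesis .
qed

lemma blocking_matrix_dim [simp]:
  "dim_row (blocking_matrix s) = sum_list s" "dim_col (blocking_matrix s) = length s"
  by (induction s) (simp_all add: blocking_matrix_def Let_def)

lemma blocking_matrix_Cons:
  "blocking_matrix (l # s) =
     four_block_mat (Matrix.mat l 1 (\<lambda>_. 1)) (0\<^sub>m l (length s))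
       (0\<^sub>m (sum_list s) 1) (blocking_matrix s)"
  using blocking_matrix_dim[of s] by (simp add: blocking_matrix_def Let_def)

text \<open>A block of length 1 occupies only the first row and the first column; the left factor
  deletes that row and the right factor that column.\<close>

lemma blocking_matrix_drop_unit_block:
  "zero_id (sum_list s) * blocking_matrix (1 # s) * transpose_mat (zero_id (length s))
     = blocking_matrix s"
proof (rule eq_matI)
  fix i j assume "i < dim_row (blocking_matrix s)" "j < dim_col (blocking_matrix s)"
  then show "(zero_id (sum_list s) * blocking_matrix (1 # s) * transpose_mat (zero_id (length s))) $$ (i, j)
      = blocking_matrix s $$ (i, j)"
    by (simp add: mult_transpose_zero_id_index zero_id_mult_index blocking_matrix_Cons del: index_mult_mat(1))
qed simp_all

section \<open>Blocked input sequences\<close>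

lemma blocked_inputs_dim [simp]: "dim_vec (blocked_inputs M V) = dim_row M"
  by (simp add: blocked_inputs_def block_mult_vec_def kronecker_def)

text \<open>The blocks of the Kronecker product with the identity are scalar multiples of the
  identity, so each acts as a scaling.\<close>

lemma blocked_inputs_index:
  assumes "i < dim_row M"
  shows "vec_index (blocked_inputs M V) i = (\<Sum>j<dim_col M. M $$ (i, j) *\<^sub>R vec_index V j)"
  using assms by (simp add: blocked_inputs_def block_mult_vec_def kronecker_def scaleR_matrix_vector_assoc[symmetric])

lemma blocked_inputs_zero_id_mult:
  assumes "dim_row M = Suc r" "i < r"
  shows "vec_index (blocked_inputs (zero_id r * M) V) i = vec_index (blocked_inputs M V) (Suc i)"
  using assms by (simp add: blocked_inputs_index zero_id_mult_index del: index_mult_mat(1))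

text \<open>A blocking matrix acts as run-length decoding: \<open>s\<close> gives the lengths of the
  runs and \<open>vs\<close> their values. This turns dropping and splitting blocks into identities
  of lists. Zero lengths are allowed and give empty runs.\<close>

lemma blocked_inputs_blocking_matrix:
  assumes "length s = length vs"
  shows "blocked_inputs (blocking_matrix s) (vec_of_list vs)
           = vec_of_list (concat (map2 replicate s vs))"
  using assms
proof (induction s vs rule: list_induct2)
  case Nil
  show ?case by (intro eq_vecI) simp_all
next
  case (Cons l s v vs)
  \<comment> \<open>The induction hypothesis equates two vectors, hence also their
    dimensions.\<close>
  have len: "length (concat (map2 replicate s vs)) = sum_list s"
    using Cons.IH by (metis blocked_inputs_dim blocking_matrix_dim(1) dim_vec_of_list)
  show ?case
  proof (rule eq_vecI)
    fix i assume "i < dim_vec (vec_of_list (concat (map2 replicate (l # s) (v # vs))))"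
    then have i: "i < l + sum_list s" using len by simp
    \<comment> \<open>Column 0 carries the first block and is separated from the rest: the rows
      \<open>i < l\<close> see only \<open>v\<close>, and the later rows see only the remaining
      blocks, with row index \<open>i - l\<close>.\<close>
    have row: "vec_index (blocked_inputs (blocking_matrix (l # s)) (vec_of_list (v # vs))) i =
        blocking_matrix (l # s) $$ (i, 0) *\<^sub>R v +
        (\<Sum>j<length s. blocking_matrix (l # s) $$ (i, Suc j) *\<^sub>R vec_index (vec_of_list vs) j)"
      using i by (simp add: blocked_inputs_index sum.lessThan_Suc_shift del: sum.lessThan_Suc)
    show "vec_index (blocked_inputs (blocking_matrix (l # s)) (vec_of_list (v # vs))) i =
        vec_index (vec_of_list (concat (map2 replicate (l # s) (v # vs)))) i"
    proof (cases "i < l")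
      case True
      then have "blocking_matrix (l # s) $$ (i, 0) = 1"
        "\<And>j. j < length s \<Longrightarrow> blocking_matrix (l # s) $$ (i, Suc j) = 0"
        by (simp_all add: blocking_matrix_Cons)
      with True show ?thesis unfolding row
        by (simp add: nth_append vec_of_list_index)
    next
      case False
      then have "blocking_matrix (l # s) $$ (i, 0) = 0"
        "\<And>j. j < length s \<Longrightarrow> blocking_matrix (l # s) $$ (i, Suc j) = blocking_matrix s $$ (i - l, j)"
        using i by (simp_all add: blocking_matrix_Cons)
      then have "vec_index (blocked_inputs (blocking_matrix (l # s)) (vec_of_list (v # vs))) i =
          vec_index (blocked_inputs (blocking_matrix s) (vec_of_list vs)) (i - l)"
        unfolding row using i False by (simp add: blocked_inputs_index)
      with False show ?thesis by (simp add: Cons.IH nth_append vec_of_list_index)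
    qed
  qed (simp add: len)
qed

section \<open>Input sequences under splitting and under Gamma\<close>

text \<open>A run of length \<open>s ! j\<close> is the concatenation of runs of lengths
  \<open>s ! j - i\<close> and \<open>i\<close> with the same value, so repeating entry
  \<open>j\<close> reproduces the old sequence.\<close>

lemma splits_blocked_inputs:
  assumes "M' \<in> splits M" and "Vbar \<in> carrier_vec (dim_col M)"
  obtains Vbar' where "Vbar' \<in> carrier_vec (dim_col M')"
    "blocked_inputs M' Vbar' = blocked_inputs M Vbar"
proof -
  obtain s j i where M': "M' = blocking_matrix (take j s @ [s ! j - i, i] @ drop (Suc j) s)"
    and M: "M = blocking_matrix s" and j: "j < length s" and i: "1 \<le> i" "i \<le> s ! j - 1"
    using assms(1) unfolding splits_def by auto
  define vs where "vs = list_of_vec Vbar"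
  have len: "length vs = length s" and vs: "Vbar = vec_of_list vs"
    using assms(2) by (auto simp: vs_def M vec_list)
  define vs' where "vs' = take j vs @ [vs ! j, vs ! j] @ drop (Suc j) vs"
  have s_split: "s = take j s @ [s ! j] @ drop (Suc j) s"
    using j by (simp add: Cons_nth_drop_Suc)
  have vs_split: "vs = take j vs @ [vs ! j] @ drop (Suc j) vs"
    using j len by (simp add: Cons_nth_drop_Suc)
  have "concat (map2 replicate (take j s @ [s ! j - i, i] @ drop (Suc j) s) vs')
      = concat (map2 replicate (take j s) (take j vs)) @ replicate (s ! j - i) (vs ! j)
          @ replicate i (vs ! j) @ concat (map2 replicate (drop (Suc j) s) (drop (Suc j) vs))"
    using j len by (simp add: vs'_def)
  \<comment> \<open>The bound on \<open>i\<close> makes the truncated subtraction exact, so the two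
    run lengths add up to \<open>s ! j\<close>.\<close>
  also have "\<dots> = concat (map2 replicate (take j s) (take j vs)) @ replicate (s ! j) (vs ! j)
          @ concat (map2 replicate (drop (Suc j) s) (drop (Suc j) vs))"
    using i by (simp flip: append_assoc replicate_add)
  also have "\<dots> = concat (map2 replicate (take j s @ [s ! j] @ drop (Suc j) s)
      (take j vs @ [vs ! j] @ drop (Suc j) vs))"
    using j len by simp
  also have "\<dots> = concat (map2 replicate s vs)"
    using s_split vs_split by metis
  finally have eq: "concat (map2 replicate (take j s @ [s ! j - i, i] @ drop (Suc j) s) vs')
      = concat (map2 replicate s vs)" .
  have len': "length (take j s @ [s ! j - i, i] @ drop (Suc j) s) = length vs'"
    using j len by (simp add: vs'_def)
  show ?thesis
  proof
    show "vec_of_list vs' \<in> carrier_vec (dim_col M')"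
      by (rule carrier_vecI) (simp only: M' dim_vec_of_list blocking_matrix_dim len')
    show "blocked_inputs M' (vec_of_list vs') = blocked_inputs M Vbar"
      unfolding M' M vs blocked_inputs_blocking_matrix[OF len']
        blocked_inputs_blocking_matrix[OF len[symmetric]] eq ..
  qed
qed

text \<open>The constraints depend on the decision vector only through the input sequence it
  generates, so recursive feasibility needs just this: whichever value Gamma takes, the tail of the
  old sequence can still be generated.\<close>

lemma Gamma_values_blocked_inputs:
  assumes "M' \<in> Gamma_values Nmax M" "dim_row M = Suc r" "Vbar \<in> carrier_vec (dim_col M)"
  obtains Vbar' where "Vbar' \<in> carrier_vec (dim_col M')" "dim_row M' = r"
    "\<And>i. i < r \<Longrightarrow> vec_index (blocked_inputs M' Vbar') i = vec_index (blocked_inputs M Vbar) (Suc i)"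
proof -
  obtain s where s: "s \<noteq> []" and M: "M = blocking_matrix s"
    and M': "if hd s = 1 \<and> dim_row M > Nmax
        then M' \<in> splits (zero_id r * M * transpose_mat (zero_id (dim_col M - 1)))
        else M' = zero_id r * M"
    using assms(1) unfolding Gamma_values_def Let_def mem_Collect_eq assms(2) diff_Suc_1 by blast
  show ?thesis
  proof (cases "hd s = 1 \<and> dim_row M > Nmax")
    \<comment> \<open>If \<open>hd s = 1\<close> here, deleting the row leaves a zero first column;
      the first entry of \<open>Vbar\<close> then has no effect and may stay.\<close>
    case False
    then have "M' = zero_id r * M" using M' by simp
    then show ?thesis
      using that[of Vbar] assms(2,3) blocked_inputs_zero_id_mult by auto
  next
    case True
    then obtain t where t: "s = 1 # t" using s by (cases s) auto
    then have r: "r = sum_list t" using assms(2) M by simp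
    have split: "M' \<in> splits (blocking_matrix t)"
      using M' True blocking_matrix_drop_unit_block[of t] unfolding M t r by simp
    have len_Vbar: "length (list_of_vec Vbar) = Suc (length t)"
      using carrier_vecD[OF assms(3)] by (simp add: M t)
    then obtain v vs where vs: "list_of_vec Vbar = v # vs"
      by (cases "list_of_vec Vbar") (simp_all only: list.size nat.distinct)
    then have len: "length vs = length t" using len_Vbar by simp
    have Vbar: "Vbar = vec_of_list (v # vs)"
      using vec_list[of Vbar] by (simp only: vs)
    have "vec_of_list vs \<in> carrier_vec (dim_col (blocking_matrix t))"
      by (rule carrier_vecI) (simp only: dim_vec_of_list blocking_matrix_dim len)
    then obtain Vbar' where Vbar': "Vbar' \<in> carrier_vec (dim_col M')"
      and eq: "blocked_inputs M' Vbar' = blocked_inputs (blocking_matrix t) (vec_of_list vs)"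
      using splits_blocked_inputs[OF split] by blast
    \<comment> \<open>Equal sequences have equal length, which gives the row count after the
      split.\<close>
    have "dim_row M' = r" using arg_cong[OF eq, of dim_vec] by (simp add: r)
    \<comment> \<open>Decoding \<open>1 # t\<close> puts the single value \<open>v\<close> in front
      of the decoding of \<open>t\<close>, hence the index shift by one.\<close>
    moreover have "vec_index (blocked_inputs M' Vbar') i = vec_index (blocked_inputs M Vbar) (Suc i)" for i
      unfolding eq M t Vbar using len
      by (simp add: blocked_inputs_blocking_matrix vec_of_list_index nth_append
          del: vec_of_list_Cons One_nat_def)
    ultimately show ?thesis using that Vbar' by blast
  qed
qed

section \<open>Shifted nominal trajectories and the error tube\<close>

lemma nominal_state_shift:
  assumes "\<And>j. j < i \<Longrightarrow> vec_index V' j = vec_index V (Suc j)"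
  shows "nominal_state A B (A *v z0 + B *v vec_index V 0) V' i = nominal_state A B z0 V (Suc i)"
  using assms by (induction i) simp_all

text \<open>Since the horizon shrinks by one, the shifted trajectory ends in the same terminal state
  and its stage constraints are among the old ones. Only membership of \<open>x'\<close> in the tube
  is new.\<close>

lemma mpc_constraints_shift:
  assumes "mpc_constraints A B K F XT Z x M z0 Vbar"
    and "dim_row M = Suc (dim_row M')" "Vbar' \<in> carrier_vec (dim_col M')"
    and shift: "\<And>i. i < dim_row M' \<Longrightarrow>
      vec_index (blocked_inputs M' Vbar') i = vec_index (blocked_inputs M Vbar) (Suc i)"
    and "x' \<in> {A *v z0 + B *v vec_index (blocked_inputs M Vbar) 0} + Z"
  shows "mpc_constraints A B K F XT Z x' M'
           (A *v z0 + B *v vec_index (blocked_inputs M Vbar) 0) Vbar'"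
proof -
  have "nominal_state A B (A *v z0 + B *v vec_index (blocked_inputs M Vbar) 0) (blocked_inputs M' Vbar') i
      = nominal_state A B z0 (blocked_inputs M Vbar) (Suc i)" if "i \<le> dim_row M'" for i
    using that shift by (intro nominal_state_shift) simp
  with assms show ?thesis
    unfolding mpc_constraints_def Let_def by (simp del: nominal_state.simps)
qed

text \<open>The error \<open>e = x - z0\<close> evolves as \<open>(A - B ** K) *v e + w\<close>,
  which stays in \<open>Z\<close> by robust invariance.\<close>

lemma tube_step:
  fixes A :: "real^'n^'n" and B :: "real^'m^'n" and K :: "real^'n^'m"
  assumes "robust_positively_invariant (A - B ** K) W Z" "x \<in> {z0} + Z" "w \<in> W"
  shows "A *v x + B *v (v - K *v (x - z0)) + w \<in> {A *v z0 + B *v v} + Z"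
proof -
  obtain e where e: "e \<in> Z" "x = z0 + e"
    using assms(2) by (auto simp: set_plus_def)
  have "(A - B ** K) *v e + w \<in> Z"
    using assms(1,3) e(1) unfolding robust_positively_invariant_def by (blast intro: set_plus_intro)
  moreover have "A *v x + B *v (v - K *v (x - z0)) + w = (A *v z0 + B *v v) + ((A - B ** K) *v e + w)"
    by (simp add: e(2) matrix_vector_mult_diff_rdistrib matrix_vector_mult_diff_distrib
        matrix_vector_right_distrib matrix_vector_mul_assoc)
  ultimately show ?thesis by (auto simp: set_plus_def)
qed

(* The optimality assumption is conditional on feasibility: feasibility at times k >= 1 is part of
   the conclusion.  It also contains the convention that the minimum is attained when the problem
   is feasible. *)
theorem theorem1:
  fixes A :: "real^'n^'n" and B :: "real^'m^'n" and K :: "real^'n^'m"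
    and F :: "(real^('n + 'm)) set" and XT W Z :: "(real^'n) set"
    and H :: "real^('n + 'm)^('n + 'm)" and P :: "real^'n^'n"
    and N0 Nbar Nmax :: nat and M :: "nat \<Rightarrow> real mat"
    and x w :: "nat \<Rightarrow> real^'n" and u :: "nat \<Rightarrow> real^'m"
    and z0 :: "nat \<Rightarrow> real^'n" and Vbar :: "nat \<Rightarrow> (real^'m) Matrix.vec"
  assumes "stabilizable A B"
    and "polytope F" "0 \<in> F"
    and "polytope XT" "0 \<in> XT"
    and "polytope W" "0 \<in> W"
    and "asymptotically_stable (A - B ** K)"
    and "robust_positively_invariant (A - B ** K) W Z"
    and "positive_definite H" "positive_definite P"
    and "Nmax \<ge> 1" "N0 \<ge> 1"
    and "M 0 \<in> carrier_mat N0 Nbar" "is_blocking_matrix (M 0)" "Nbar \<le> Nmax"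
    and "\<And>k. k \<in> {1..N0 - 1} \<Longrightarrow> M k \<in> Gamma_values Nmax (M (k - 1))"
    and "mpc_feasible A B K F XT Z (x 0) (M 0)"
    and "\<And>k. k < N0 \<Longrightarrow> mpc_feasible A B K F XT Z (x k) (M k) \<Longrightarrow>
           mpc_optimal A B K F XT Z H P (x k) (M k) (z0 k) (Vbar k)"
    and "\<And>k. k < N0 \<Longrightarrow>
           u k = vec_index (blocked_inputs (M k) (Vbar k)) 0 - K *v (x k - z0 k)"
    and "\<And>k. k < N0 \<Longrightarrow> w k \<in> W"
    and "\<And>k. k < N0 \<Longrightarrow> x (Suc k) = A *v x k + B *v u k + w k"
  shows "(\<forall>k \<in> {1..N0 - 1}. mpc_feasible A B K F XT Z (x k) (M k)) \<and> x N0 \<in> XT"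
proof -
  have step: "x (Suc k) \<in> {A *v z0 k + B *v vec_index (blocked_inputs (M k) (Vbar k)) 0} + Z"
    and constr: "mpc_constraints A B K F XT Z (x k) (M k) (z0 k) (Vbar k)"
    if k: "k < N0" and feas: "mpc_feasible A B K F XT Z (x k) (M k)" for k
  proof -
    show constr: "mpc_constraints A B K F XT Z (x k) (M k) (z0 k) (Vbar k)"
      using assms(19)[OF k feas] unfolding mpc_optimal_def by blast
    then have "x k \<in> {z0 k} + Z"
      unfolding mpc_constraints_def Let_def by blast
    then show "x (Suc k) \<in> {A *v z0 k + B *v vec_index (blocked_inputs (M k) (Vbar k)) 0} + Z"
      using tube_step[OF assms(9) _ assms(21)[OF k]] by (simp add: assms(20,22)[OF k])
  qed
  \<comment> \<open>The row count is carried through the induction: it shows that a leading row is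
    left to delete and that the last problem has horizon 1.\<close>
  have main: "dim_row (M k) = N0 - k \<and> mpc_feasible A B K F XT Z (x k) (M k)" if "k < N0" for k
    using that
  proof (induction k)
    case 0
    show ?case using assms(14,18) by auto
  next
    case (Suc k)
    then have k: "k < N0" and feas: "mpc_feasible A B K F XT Z (x k) (M k)"
      and dim: "dim_row (M k) = Suc (N0 - Suc k)" by simp_all
    have Gamma: "M (Suc k) \<in> Gamma_values Nmax (M k)"
      using assms(17)[of "Suc k"] Suc.prems by simp
    have "Vbar k \<in> carrier_vec (dim_col (M k))"
      using constr[OF k feas] unfolding mpc_constraints_def by blast
    then obtain Vbar' where V': "Vbar' \<in> carrier_vec (dim_col (M (Suc k)))"
      "dim_row (M (Suc k)) = N0 - Suc k"
      "\<And>i. i < N0 - Suc k \<Longrightarrow> vec_index (blocked_inputs (M (Suc k)) Vbar') i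
             = vec_index (blocked_inputs (M k) (Vbar k)) (Suc i)"
      using Gamma_values_blocked_inputs[OF Gamma dim] by blast
    have "mpc_constraints A B K F XT Z (x (Suc k)) (M (Suc k))
        (A *v z0 k + B *v vec_index (blocked_inputs (M k) (Vbar k)) 0) Vbar'"
      by (rule mpc_constraints_shift[OF constr[OF k feas] _ V'(1) _ step[OF k feas]])
        (simp_all add: V'(2,3) dim)
    then show ?case
      using V'(2) unfolding mpc_feasible_def by blast
  qed
  \<comment> \<open>The last problem has horizon 1, so its terminal state is the nominal successor.
    That state lies in the terminal set tightened by \<open>Z\<close>, and \<open>x N0\<close>
    differs from it by an element of \<open>Z\<close>.\<close>
  define k where "k = N0 - 1"
  then have k: "k < N0" "Suc k = N0" using assms(13) by simp_all
  have dim: "dim_row (M k) = 1" and feas: "mpc_feasible A B K F XT Z (x k) (M k)"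
    using main[OF k(1)] k(2) by auto
  have "A *v z0 k + B *v vec_index (blocked_inputs (M k) (Vbar k)) 0 \<in> pontryagin_diff XT Z"
    using constr[OF k(1) feas] unfolding mpc_constraints_def Let_def dim by simp
  then have "x N0 \<in> XT"
    using step[OF k(1) feas] k(2) by (auto simp: pontryagin_diff_def)
  with main show ?thesis using assms(13) by auto
qed

end
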